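(* Let $2\le i\le n$ and let $\alpha_{i+1},\ldots,\alpha_n\in\mathbb{R}$ be fixed. Let $\mu^{(i)}\in\mathbb{R}^i$ be a fixed point of the map $\mathbf{H}_i$ defined in the context, and suppose that $\mathbf{F}_i(\mu^{(i)})=\mathbf{0}$ and that: (1) $\frac{\partial F_i}{\partial\lambda_i}(\mu^{(i)})\neq 0$; (2) the $i\times i$ matrix $\mathbf{F}_{i,\boldsymbol{\lambda}_i}(\mu^{(i)})$ is nonsingular; (3) each component of $\mathbf{F}_i$ is twice differentiable in a closed region of $\mathbb{R}^i$ whose interior contains $\mu^{(i)}$. Let $\sigma_1,\ldots,\sigma_{i-1}$ be the eigenvalues of the $(i-1)\times(i-1)$ matrix $\mathbf{F}_{i-1,\boldsymbol{\lambda}_{i-1}}(\mu^{(i)})$, ordered so that $|\sigma_1|\ge|\sigma_2|\ge\cdots\ge|\sigma_{i-1}|$. If $$\left|\Big(\frac{\partial F_i}{\partial\lambda_i}(\mu^{(i)})\Big)^{-1}\sum_{j=1}^{i-1}\frac{\partial F_j}{\partial\lambda_i}(\mu^{(i)})\,\frac{\partial F_i}{\partial\lambda_j}(\mu^{(i)})\right|<|\sigma_{i-1}|,$$ then $\mu^{(i)}$ is a locally attracting fixed point of $\mathbf{H}_i$.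
   Context: Let $\Omega=[-1,1]^d$, and let $c_1,\ldots,c_n$ be an enumeration of the monomials $\mathbf{x}^{\mathbf{j}}=\prod_{k=1}^d x_k^{j_k}$ on $\Omega$ with $\mathbf{j}\in\mathbb{Z}_+^d$, $1\le|\mathbf{j}|\le p$ (so $n=\sum_{j=1}^p\binom{j+d-1}{d-1}$). Let $f_1,\ldots,f_n\in\mathbb{R}$ be given numbers (the prescribed moments). For $j=1,\ldots,n$ define $$F_j(\lambda_1,\ldots,\lambda_n)=\int_\Omega (c_j(\mathbf{x})-f_j)\exp\Big(\sum_{k=1}^n\lambda_k c_k(\mathbf{x})\Big)\,d\mathbf{x}.$$ For $1\le k\le n$ put $\mathbf{F}_k=(F_1,\ldots,F_k)$ and $\boldsymbol{\lambda}_k=(\lambda_1,\ldots,\lambda_k)$. Fix $i\in\{2,\ldots,n\}$ and real numbers $\alpha_{i+1},\ldots,\alpha_n$. All functions $F_1,\ldots,F_i$ are regarded as functions of $\boldsymbol{\lambda}_i=(\boldsymbol{\lambda}_{i-1},\lambda_i)\in\mathbb{R}^i$ by setting $\lambda_{k}=\alpha_{k}$ for $k>i$, and these frozen arguments are suppressed from the notation. For $k\le i$, $\mathbf{F}_{k,\boldsymbol{\lambda}_{k}}$ denotes the $k\times k$ Jacobian matrix of $\mathbf{F}_{k}$ with respect to $\lambda_1,\ldots,\lambda_{k}$, and $\mathbf{F}_{i-1,\lambda_i}\in\mathbb{R}^{i-1}$ denotes the column vector of partial derivatives of $\mathbf{F}_{i-1}$ with respect to $\lambda_i$. The map $\mathbf{H}_i=(\mathbf{H}_{i,1},H_{i,2})$,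 with values in $\mathbb{R}^{i-1}\times\mathbb{R}=\mathbb{R}^i$, is defined at every $(\boldsymbol{\lambda}_{i-1},\lambda_i)$ at which the inverses below exist by $$H_{i,2}(\boldsymbol{\lambda}_{i-1},\lambda_i)=\lambda_i-\Big(\frac{\partial F_i}{\partial\lambda_i}(\boldsymbol{\lambda}_{i-1},\lambda_i)\Big)^{-1}F_i(\boldsymbol{\lambda}_{i-1},\lambda_i),$$ $$\mathbf{g}_i=\boldsymbol{\lambda}_{i-1}-\mathbf{F}_{i-1,\boldsymbol{\lambda}_{i-1}}(\boldsymbol{\lambda}_{i-1},\lambda_i)^{-1}\,\mathbf{F}_{i-1,\lambda_i}(\boldsymbol{\lambda}_{i-1},\lambda_i)\,(H_{i,2}-\lambda_i),$$ $$\mathbf{H}_{i,1}(\boldsymbol{\lambda}_{i-1},\lambda_i)=\mathbf{g}_i-\mathbf{F}_{i-1,\boldsymbol{\lambda}_{i-1}}(\mathbf{g}_i,H_{i,2})^{-1}\,\mathbf{F}_{i-1}(\mathbf{g}_i,H_{i,2}).$$ A fixed point $\mu$ of $\mathbf{H}_i$ (a point at which $\mathbf{H}_i$ is defined with $\mathbf{H}_i(\mu)=\mu$) is called locally attracting if there is a neighborhood of $\mu$ such that, for every starting point in it, all iterates of $\mathbf{H}_i$ are defined and converge to $\mu$. *)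

theory Defs
  imports "HOL-Analysis.Analysis" "HOL-Computational_Algebra.Polynomial"
begin

definition cube :: "(real ^ 'd) set" where
  "cube = cbox (\<chi> k. - 1) (\<chi> k. 1)"

definition monomial_fun :: "('d::finite \<Rightarrow> nat) \<Rightarrow> real ^ 'd \<Rightarrow> real" where
  "monomial_fun J x = (\<Prod>k\<in>UNIV. (x $ k) ^ J k)"

definition monomials_upto :: "nat \<Rightarrow> (real ^ 'd \<Rightarrow> real) set" where
  "monomials_upto p = monomial_fun ` {J. 1 \<le> (\<Sum>k\<in>UNIV. J k) \<and> (\<Sum>k\<in>UNIV. J k) \<le> p}"

text \<open>
  The residual \<open>F\<^sub>j\<close>. All sequences are indexed from 1; a parameter vector
  \<open>(\<lambda>\<^sub>1, \<dots>, \<lambda>\<^sub>n)\<close> is a function on \<open>nat\<close> of which only the values at \<open>1, \<dots>, n\<close> are used.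
\<close>
definition moment_residual ::
  "nat \<Rightarrow> (nat \<Rightarrow> real ^ 'd \<Rightarrow> real) \<Rightarrow> (nat \<Rightarrow> real) \<Rightarrow> nat \<Rightarrow> (nat \<Rightarrow> real) \<Rightarrow> real" where
  "moment_residual n c f j l =
     integral cube (\<lambda>x. (c j x - f j) * exp (\<Sum>k=1..n. l k * c k x))"

text \<open>
  Points \<open>(\<lambda>\<^sub>1, \<dots>, \<lambda>\<^sub>i)\<close> are elements of \<open>(real ^ 'm) \<times> real\<close>, where \<open>\<iota>\<close> is a bijection from
  the index type \<open>'m\<close> onto \<open>{1..<i}\<close>: the component of index \<open>a\<close> is the parameter number \<open>\<iota> a\<close>.
  The following function fills in the frozen parameters \<open>\<alpha>\<^sub>k\<close>, \<open>k > i\<close>.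
\<close>
definition params ::
  "('m::finite \<Rightarrow> nat) \<Rightarrow> nat \<Rightarrow> (nat \<Rightarrow> real) \<Rightarrow> (real ^ 'm) \<times> real \<Rightarrow> nat \<Rightarrow> real" where
  "params \<iota> i \<alpha> x k =
     (if k \<in> range \<iota> then fst x $ inv \<iota> k else if k = i then snd x else \<alpha> k)"

definition partial :: "((nat \<Rightarrow> real) \<Rightarrow> real) \<Rightarrow> nat \<Rightarrow> (nat \<Rightarrow> real) \<Rightarrow> real" where
  "partial G k l = deriv (\<lambda>t. G (l(k := t))) (l k)"

text \<open>
  Below \<open>\<kappa>\<close> numbers the components of vectors and the rows and columns of matrices:
  \<open>\<kappa> = \<iota>\<close> gives the system of size \<open>i - 1\<close>, and \<open>\<kappa> = case_option i \<iota>\<close> the one of size \<open>i\<close>.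
\<close>
definition Fvec ::
  "(nat \<Rightarrow> (nat \<Rightarrow> real) \<Rightarrow> real) \<Rightarrow> ('k::finite \<Rightarrow> nat) \<Rightarrow> (nat \<Rightarrow> real) \<Rightarrow> real ^ 'k" where
  "Fvec F \<kappa> l = (\<chi> a. F (\<kappa> a) l)"

definition Fjac ::
  "(nat \<Rightarrow> (nat \<Rightarrow> real) \<Rightarrow> real) \<Rightarrow> ('k::finite \<Rightarrow> nat) \<Rightarrow> (nat \<Rightarrow> real) \<Rightarrow> real ^ 'k ^ 'k" where
  "Fjac F \<kappa> l = (\<chi> a b. partial (F (\<kappa> a)) (\<kappa> b) l)"

definition Fcol ::
  "(nat \<Rightarrow> (nat \<Rightarrow> real) \<Rightarrow> real) \<Rightarrow> ('k::finite \<Rightarrow> nat) \<Rightarrow> nat \<Rightarrow> (nat \<Rightarrow> real) \<Rightarrow> real ^ 'k" where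
  "Fcol F \<kappa> j l = (\<chi> a. partial (F (\<kappa> a)) j l)"

text \<open>The value \<open>None\<close> of \<open>Hmap\<close> means that one of the inverses does not exist.\<close>
definition Hmap ::
  "(nat \<Rightarrow> (nat \<Rightarrow> real) \<Rightarrow> real) \<Rightarrow> ('m::finite \<Rightarrow> nat) \<Rightarrow> nat \<Rightarrow> (nat \<Rightarrow> real)
    \<Rightarrow> (real ^ 'm) \<times> real \<Rightarrow> ((real ^ 'm) \<times> real) option" where
  "Hmap F \<iota> i \<alpha> x =
    (let l = params \<iota> i \<alpha> x;
         h = snd x - inverse (partial (F i) i l) * F i l;
         g = fst x - (h - snd x) *\<^sub>R (matrix_inv (Fjac F \<iota> l) *v Fcol F \<iota> i l);
         l' = params \<iota> i \<alpha> (g, h)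
     in if partial (F i) i l \<noteq> 0 \<and> invertible (Fjac F \<iota> l) \<and> invertible (Fjac F \<iota> l')
        then Some (g - matrix_inv (Fjac F \<iota> l') *v Fvec F \<iota> l', h)
        else None)"

definition locally_attracting :: "('a::topological_space \<Rightarrow> 'a option) \<Rightarrow> 'a \<Rightarrow> bool" where
  "locally_attracting H \<mu> \<longleftrightarrow>
     H \<mu> = Some \<mu> \<and>
     (\<exists>U. open U \<and> \<mu> \<in> U \<and>
       (\<forall>x\<in>U. \<exists>s. s 0 = x \<and> (\<forall>k. H (s k) = Some (s (Suc k))) \<and> s \<longlonglongrightarrow> \<mu>))"

definition twice_differentiable_on ::
  "('a::real_normed_vector \<Rightarrow> 'b::real_normed_vector) \<Rightarrow> 'a set \<Rightarrow> bool" where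
  "twice_differentiable_on G S \<longleftrightarrow>
     (\<exists>G'. (\<forall>x\<in>S. (G has_derivative blinfun_apply (G' x)) (at x within S))
           \<and> G' differentiable_on S)"

text \<open>
  The characteristic polynomial \<open>det (X I - A)\<close> over the complex numbers; its factorization
  into linear factors lists the eigenvalues of \<open>A\<close> with algebraic multiplicity.
\<close>
definition complex_charpoly :: "real ^ 'k ^ 'k \<Rightarrow> complex poly" where
  "complex_charpoly A =
     det (\<chi> a b. (if a = b then [:0, 1:] else 0) - [:complex_of_real (A $ a $ b):])"

definition eigenvalues_by_modulus :: "real ^ 'k ^ 'k \<Rightarrow> (nat \<Rightarrow> complex) \<Rightarrow> bool" where
  "eigenvalues_by_modulus A \<sigma> \<longleftrightarrow>
     complex_charpoly A = (\<Prod>j=1..CARD('k). [:- \<sigma> j, 1:]) \<and>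
     (\<forall>j k. 1 \<le> j \<and> j \<le> k \<and> k \<le> CARD('k) \<longrightarrow> cmod (\<sigma> k) \<le> cmod (\<sigma> j))"

end

theory Submission
  imports Defs
begin

text \<open>
  The map \<open>Hmap\<close> is a Newton step in \<open>\<lambda>\<^sub>i\<close>, a first-order prediction of the remaining parameters
  along the curve on which \<open>F\<^sub>1, \<dots>, F\<^sub>i\<^sub>-\<^sub>1\<close> keep their values, and a Newton correction of that
  prediction. Near the zero \<open>\<mu>\<close> of the residuals the prediction and both Newton corrections are products of
  a factor that is continuous at \<open>\<mu>\<close> and a factor that vanishes at \<open>\<mu>\<close>. Hence in the product rule
  only the derivative of the vanishing factor survives, and no derivative of an inverse Jacobian
  ever appears. Write the full Jacobian at \<open>\<mu>\<close> in blocks, \<open>A\<close> for the leading one, \<open>b\<close> for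
  the last column, \<open>r\<close> for the last row and \<open>d\<close> for the corner. The correction in the first
  block cancels everything except the effect of the change in \<open>\<lambda>\<^sub>i\<close>, and the derivative of
  \<open>Hmap\<close> at \<open>\<mu>\<close> has rank at most one: it sends \<open>(x, t)\<close> to \<open>(r \<bullet> x / d) \<cdot> (v, - 1)\<close>
  with \<open>v = A\<^sup>-\<^sup>1 b\<close> (\<open>Hmap_derivative\<close>). Its only possibly nonzero eigenvalue is
  \<open>r \<bullet> v / d\<close>, and such a derivative whose eigenvalue has modulus below 1 makes the fixed
  point attracting (\<open>locally_attracting_rank_one\<close>).

  The eigenvalue is controlled by the special form of the residuals. Differentiating under the
  integral brings down a factor \<open>c\<^sub>k\<close>; since the integrals of \<open>c\<^sub>j - f\<^sub>j\<close> against the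
  exponential density vanish at \<open>\<mu>\<close>, this factor may be replaced by \<open>c\<^sub>k - f\<^sub>k\<close>. So the
  Jacobian at \<open>\<mu>\<close> is the Gram matrix of the functions \<open>c\<^sub>j - f\<^sub>j\<close> with respect to that density
  (\<open>Fjac_gram\<close>): it is symmetric and positive semidefinite, and being nonsingular it is positive
  definite. Then \<open>r \<bullet> v = b \<bullet> A\<^sup>-\<^sup>1 b\<close> is nonnegative, and the Schur complement
  \<open>d - b \<bullet> A\<^sup>-\<^sup>1 b\<close> is positive (\<open>schur_complement_pos\<close>). Dividing by \<open>d\<close> puts the
  eigenvalue in the interval from 0 (included) to 1 (excluded).
\<close>

section \<open>Products with a vanishing factor\<close>

lemma bounded_bilinear_matrix_vector_mult:
  "bounded_bilinear (\<lambda>(A :: real ^ 'n ^ 'm) x. A *v x)"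
  unfolding bilinear_conv_bounded_bilinear[symmetric] bilinear_def
  by (auto intro!: linearI simp: vec_eq_iff matrix_vector_mult_def algebra_simps
      sum.distrib sum_distrib_left)

text \<open>
  A factor in front of a vanishing function contributes only its limit to the derivative of the
  product: its increment is multiplied by \<open>g x\<close>, which is of first order. So continuity of the
  first factor is enough, and the inverse Jacobians in \<open>Hmap\<close> never have to be differentiated.
\<close>

lemma (in bounded_bilinear) has_derivative_prod_zero:
  assumes f: "(f \<longlongrightarrow> u) (at a)" and g: "(g has_derivative g') (at a)" and 0: "g a = 0"
  shows "((\<lambda>x. prod (f x) (g x)) has_derivative (\<lambda>z. prod u (g' z))) (at a)"
proof -
  have bl: "bounded_linear g'"
    using g by (rule has_derivative_bounded_linear)
  have rem: "((\<lambda>y. (g y - g' (y - a)) /\<^sub>R norm (y - a)) \<longlongrightarrow> 0) (at a)"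
    using g 0 by (simp add: has_derivative_at_within)
  have A: "((\<lambda>y. prod (f y) ((g y - g' (y - a)) /\<^sub>R norm (y - a))) \<longlongrightarrow> 0) (at a)"
    using tendsto[OF f rem] by (simp add: zero_right)
  obtain K where K: "\<And>x. norm (g' x) \<le> norm x * K" and "K > 0"
    using bounded_linear.pos_bounded[OF bl] by blast
  have "Zfun (\<lambda>y. f y - u) (at a)"
    using f by (simp add: tendsto_Zfun_iff)
  moreover have "Bfun (\<lambda>y. g' ((y - a) /\<^sub>R norm (y - a))) (at a)"
  proof (rule BfunI[where K = K], rule always_eventually, rule allI)
    fix y
    have "norm ((y - a) /\<^sub>R norm (y - a)) \<le> 1"
      by (simp add: divide_simps)
    then show "norm (g' ((y - a) /\<^sub>R norm (y - a))) \<le> K"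
      using K[of "(y - a) /\<^sub>R norm (y - a)"] \<open>K > 0\<close>
      by (meson dual_order.trans mult_left_le_one_le norm_ge_zero less_imp_le)
  qed
  ultimately have "Zfun (\<lambda>y. prod (f y - u) (g' ((y - a) /\<^sub>R norm (y - a)))) (at a)"
    by (rule Zfun_prod_Bfun)
  then have B: "((\<lambda>y. prod (f y - u) (g' ((y - a) /\<^sub>R norm (y - a)))) \<longlongrightarrow> 0) (at a)"
    by (simp add: tendsto_Zfun_iff)
  have "((\<lambda>y. (prod (f y) (g y) - prod (f a) (g a) - prod u (g' (y - a))) /\<^sub>R norm (y - a)) \<longlongrightarrow> 0) (at a)"
  proof -
    have "(prod (f y) (g y) - prod (f a) (g a) - prod u (g' (y - a))) /\<^sub>R norm (y - a)
      = prod (f y) ((g y - g' (y - a)) /\<^sub>R norm (y - a)) + prod (f y - u) (g' ((y - a) /\<^sub>R norm (y - a)))" for y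
      unfolding linear_scale[OF bounded_linear.linear[OF bl]] scaleR_right diff_left diff_right
      by (simp add: 0 zero_right scaleR_right scaleR_right_diff_distrib[symmetric]
          scaleR_add_right[symmetric] del: scaleR_diff_right scaleR_add_right)
    then show ?thesis
      using tendsto_add[OF A B] by simp
  qed
  then show ?thesis
    using bounded_linear_compose[OF bounded_linear_right bl]
    by (simp add: has_derivative_at_within o_def)
qed

lemma has_derivative_vec_lambda:
  fixes f :: "'k::finite \<Rightarrow> 'a::real_normed_vector \<Rightarrow> real"
  assumes "\<And>a. (f a has_derivative f' a) (at x)"
  shows "((\<lambda>x. \<chi> a. f a x) has_derivative (\<lambda>z. \<chi> a. f' a z)) (at x)"
  unfolding has_derivative_componentwise_within[where f = "\<lambda>x. \<chi> a. f a x"]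
  using assms by (auto simp: Basis_vec_def inner_axis)

section \<open>Continuity of the matrix inverse\<close>

lemma matrix_inv_mult:
  fixes A :: "real ^ 'n ^ 'n"
  assumes "invertible A"
  shows "A ** matrix_inv A = mat 1" "matrix_inv A ** A = mat 1"
  using assms unfolding invertible_def matrix_inv_def by (metis (mono_tags, lifting) someI_ex)+

lemma tendsto_det:
  fixes M :: "'a \<Rightarrow> real ^ 'n ^ 'n"
  assumes "(M \<longlongrightarrow> A) G"
  shows "((\<lambda>x. det (M x)) \<longlongrightarrow> det A) G"
  unfolding det_def by (intro tendsto_intros assms)

lemma eventually_invertible:
  fixes M :: "'a \<Rightarrow> real ^ 'n ^ 'n"
  assumes "(M \<longlongrightarrow> A) G" "invertible A"
  shows "\<forall>\<^sub>F x in G. invertible (M x)"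
  using tendsto_imp_eventually_ne[OF tendsto_det[OF assms(1)], of 0] assms(2)
  by (simp add: invertible_det_nz)

text \<open>
  Cramer's rule exhibits the entries of the inverse as quotients of determinants, hence as
  continuous functions of the matrix.
\<close>

lemma matrix_inv_cramer:
  fixes A :: "real ^ 'n ^ 'n"
  assumes "invertible A"
  shows "matrix_inv A = (\<chi> k l. det (\<chi> i j. if j = k then axis l 1 $ i else A $ i $ j) / det A)"
proof -
  have "A *v (matrix_inv A *v axis l 1) = axis l 1" for l
    by (simp add: matrix_vector_mul_assoc matrix_inv_mult assms)
  then have "matrix_inv A *v axis l 1
      = (\<chi> k. det (\<chi> i j. if j = k then axis l 1 $ i else A $ i $ j) / det A)" for l
    using assms by (simp add: cramer invertible_det_nz)
  then show ?thesis
    by (simp add: vec_eq_iff matrix_vector_mult_basis column_def)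
qed

lemma tendsto_matrix_inv:
  fixes M :: "'a \<Rightarrow> real ^ 'n ^ 'n"
  assumes lim: "(M \<longlongrightarrow> A) G" and "invertible A"
  shows "((\<lambda>x. matrix_inv (M x)) \<longlongrightarrow> matrix_inv A) G"
proof -
  have "((\<lambda>x. \<chi> k l. det (\<chi> i j. if j = k then axis l 1 $ i else M x $ i $ j) / det (M x))
      \<longlongrightarrow> (\<chi> k l. det (\<chi> i j. if j = k then axis l 1 $ i else A $ i $ j) / det A)) G"
  proof (intro tendsto_vec_lambda tendsto_divide tendsto_det lim)
    show "((\<lambda>x. if j = k then axis l 1 $ i else M x $ i $ j)
        \<longlongrightarrow> (if j = k then axis l 1 $ i else A $ i $ j)) G" for i j k l
      using lim by (auto intro: tendsto_intros)
    show "det A \<noteq> 0"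
      using assms by (simp add: invertible_det_nz)
  qed
  moreover have "\<forall>\<^sub>F x in G. (\<chi> k l. det (\<chi> i j. if j = k then axis l 1 $ i else M x $ i $ j) / det (M x))
      = matrix_inv (M x)"
    using eventually_invertible[OF assms] by eventually_elim (simp add: matrix_inv_cramer)
  ultimately show ?thesis
    unfolding matrix_inv_cramer[OF assms(2)] by (rule Lim_transform_eventually)
qed

lemma tendsto_matrix_vector_mult:
  fixes M :: "'a \<Rightarrow> real ^ 'n ^ 'm"
  assumes "(M \<longlongrightarrow> A) G" "(y \<longlongrightarrow> b) G"
  shows "((\<lambda>x. M x *v y x) \<longlongrightarrow> A *v b) G"
  using assms by (rule bounded_bilinear.tendsto[OF bounded_bilinear_matrix_vector_mult])

section \<open>Positivity of the Schur complement\<close>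

lemma sum_UNIV_option:
  fixes f :: "'a::finite option \<Rightarrow> 'b::comm_monoid_add"
  shows "(\<Sum>x\<in>UNIV. f x) = f None + (\<Sum>a\<in>UNIV. f (Some a))"
  by (simp add: UNIV_option_conv sum.reindex o_def)

text \<open>
  The vector \<open>v\<close> solves \<open>A v = b\<close> for the leading block \<open>A\<close> and the last column \<open>b\<close>. The
  quadratic form of \<open>M\<close> takes the value \<open>b \<bullet> v\<close> at \<open>(v, 0)\<close> and the value of the Schur
  complement \<open>\<delta>\<close> at \<open>(- v, 1)\<close>, so both are nonnegative. Moreover \<open>M\<close> maps \<open>(- v, 1)\<close> to
  \<open>(0, \<delta>)\<close>; hence \<open>\<delta> = 0\<close> would put a nonzero vector into the kernel of \<open>M\<close>.
\<close>

lemma schur_complement_pos: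
  fixes M :: "real ^ 'm::finite option ^ 'm option" and v :: "real ^ 'm"
  assumes psd: "\<And>u. 0 \<le> u \<bullet> (M *v u)" and sym: "transpose M = M" and inv: "invertible M"
    and v: "\<And>a. (\<Sum>b\<in>UNIV. M $ Some a $ Some b * v $ b) = M $ Some a $ None"
  shows "0 \<le> (\<Sum>a\<in>UNIV. M $ None $ Some a * v $ a)"
    and "(\<Sum>a\<in>UNIV. M $ None $ Some a * v $ a) < M $ None $ None"
proof -
  have s: "M $ Some a $ None = M $ None $ Some a" for a
    using arg_cong[OF sym, of "\<lambda>X. X $ None $ Some a"] by (simp add: transpose_def)
  have zero_quadratic: "(\<Sum>a\<in>UNIV. v $ a * M $ Some a $ None) = (\<Sum>a\<in>UNIV. M $ None $ Some a * v $ a)"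
    by (intro sum.cong) (auto simp: s mult.commute)
  define u where "u = (\<chi> x. case x of None \<Rightarrow> 0 | Some a \<Rightarrow> v $ a)"
  have "u \<bullet> (M *v u) = (\<Sum>a\<in>UNIV. v $ a * M $ Some a $ None)"
    by (simp add: u_def inner_vec_def matrix_vector_mult_def sum_UNIV_option v)
  then show "0 \<le> (\<Sum>a\<in>UNIV. M $ None $ Some a * v $ a)"
    using psd[of u] by (simp add: zero_quadratic)
  define w where "w = (\<chi> x. case x of None \<Rightarrow> 1 | Some a \<Rightarrow> - v $ a)"
  define \<delta> where "\<delta> = M $ None $ None - (\<Sum>a\<in>UNIV. M $ None $ Some a * v $ a)"
  have Mw: "(M *v w) $ x = (if x = None then \<delta> else 0)" for x
    by (cases x) (simp_all add: w_def \<delta>_def matrix_vector_mult_def sum_UNIV_option v sum_negf)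
  have "w \<bullet> (M *v w) = \<delta>"
    unfolding inner_vec_def Mw by (simp add: sum_UNIV_option w_def)
  then have "0 \<le> \<delta>"
    using psd[of w] by simp
  moreover have "\<delta> \<noteq> 0"
  proof
    assume "\<delta> = 0"
    then have "M *v w = 0"
      by (simp add: vec_eq_iff Mw)
    then have "w = 0"
      using inv matrix_left_invertible_ker[of M] by (metis invertible_left_inverse)
    then have "w $ None = 0"
      by simp
    then show False
      by (simp add: w_def)
  qed
  ultimately show "(\<Sum>a\<in>UNIV. M $ None $ Some a * v $ a) < M $ None $ None"
    by (simp add: \<delta>_def)
qed

section \<open>Fixed points with a rank-one derivative\<close>

text \<open>
  The derivative maps \<open>w\<close> to \<open>\<phi> w\<close> times \<open>w\<close>, but its operator norm can be large. It
  contracts in the equivalent norm \<open>N z = \<bar>\<phi> z\<bar> + \<epsilon> \<parallel>z\<parallel>\<close>: after one application of the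
  derivative, \<open>N\<close> equals \<open>(\<bar>\<phi> w\<bar> + \<epsilon> \<parallel>w\<parallel>) \<bar>\<phi> z\<bar>\<close>, and for small \<open>\<epsilon>\<close> the
  first factor is below 1. Small \<open>N\<close>-balls around \<open>\<mu>\<close> are then invariant and the iterates converge
  geometrically.
\<close>

lemma locally_attracting_rank_one:
  fixes H :: "'a::real_normed_vector \<Rightarrow> 'a option"
  assumes fix_pt: "H \<mu> = Some \<mu>"
    and H: "\<forall>\<^sub>F x in nhds \<mu>. H x = Some (G x)"
    and G: "(G has_derivative (\<lambda>z. \<phi> z *\<^sub>R w)) (at \<mu>)"
    and \<phi>: "bounded_linear \<phi>" and small: "\<bar>\<phi> w\<bar> < 1"
  shows "locally_attracting H \<mu>"
proof -
  interpret bounded_linear \<phi> by (rule \<phi>)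
  obtain K where K: "\<And>z. norm (\<phi> z) \<le> norm z * K" and "K > 0"
    using pos_bounded by blast
  \<comment> \<open>This choice makes \<open>\<bar>\<phi> w\<bar> + \<epsilon> \<parallel>w\<parallel>\<close> at most the midpoint \<open>q\<close> of \<open>\<bar>\<phi> w\<bar>\<close> and 1.\<close>
  define \<epsilon> where "\<epsilon> = (1 - \<bar>\<phi> w\<bar>) / (2 * (norm w + 1))"
  define N where "N z = \<bar>\<phi> z\<bar> + \<epsilon> * norm z" for z
  define q where "q = (1 + \<bar>\<phi> w\<bar>) / 2"
  have "\<epsilon> > 0"
    using small by (simp add: \<epsilon>_def add_nonneg_pos)
  have q: "0 \<le> q" "q < 1"
    using small by (auto simp: q_def)
  have "\<epsilon> * norm w \<le> \<epsilon> * (norm w + 1)"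
    using \<open>\<epsilon> > 0\<close> by (intro mult_left_mono) auto
  also have "\<dots> = (1 - \<bar>\<phi> w\<bar>) / 2"
    using norm_ge_zero[of w] by (simp add: \<epsilon>_def field_simps add_nonneg_eq_0_iff)
  finally have qw: "\<bar>\<phi> w\<bar> + \<epsilon> * norm w \<le> q"
    by (simp add: q_def field_simps)
  have N_step: "N (\<phi> z *\<^sub>R w) \<le> q * N z" for z
  proof -
    have "N (\<phi> z *\<^sub>R w) = (\<bar>\<phi> w\<bar> + \<epsilon> * norm w) * \<bar>\<phi> z\<bar>"
      by (simp add: N_def scaleR abs_mult algebra_simps)
    also have "\<dots> \<le> q * \<bar>\<phi> z\<bar>"
      using qw by (intro mult_right_mono) auto
    also have "\<dots> \<le> q * N z"
      using q \<open>\<epsilon> > 0\<close> by (intro mult_left_mono) (auto simp: N_def)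
    finally show ?thesis .
  qed
  have N_add: "N (y + z) \<le> N y + N z" for y z
  proof -
    have "\<epsilon> * norm (y + z) \<le> \<epsilon> * (norm y + norm z)"
      using \<open>\<epsilon> > 0\<close> by (intro mult_left_mono norm_triangle_ineq) auto
    then show ?thesis
      using abs_triangle_ineq[of "\<phi> y" "\<phi> z"] by (simp add: N_def add algebra_simps)
  qed
  define C where "C = K + \<epsilon>"
  have "C > 0"
    using \<open>K > 0\<close> \<open>\<epsilon> > 0\<close> by (simp add: C_def)
  have N_upper: "N z \<le> C * norm z" for z
    using K[of z] by (simp add: N_def C_def algebra_simps)
  have N_lower: "norm z \<le> N z / \<epsilon>" for z
    using \<open>\<epsilon> > 0\<close> by (simp add: N_def field_simps)
  \<comment> \<open>The linearization error may cost half of the remaining gap \<open>1 - q\<close>, measured in \<open>N\<close>.\<close>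
  define e where "e = (1 - q) * \<epsilon> / (2 * C)"
  have "e > 0"
    using q \<open>\<epsilon> > 0\<close> \<open>C > 0\<close> by (simp add: e_def)
  define q' where "q' = (1 + q) / 2"
  have q': "0 \<le> q'" "q' < 1"
    using q by (auto simp: q'_def)
  have G\<mu>: "G \<mu> = \<mu>"
    using eventually_nhds_x_imp_x[OF H] fix_pt by simp
  obtain \<delta>1 where "\<delta>1 > 0" and \<delta>1: "\<And>y. norm (y - \<mu>) < \<delta>1 \<Longrightarrow>
      norm (G y - G \<mu> - \<phi> (y - \<mu>) *\<^sub>R w) \<le> e * norm (y - \<mu>)"
    using G \<open>e > 0\<close> unfolding has_derivative_at_alt by blast
  obtain \<delta>2 where "\<delta>2 > 0" and \<delta>2: "\<And>y. norm (y - \<mu>) < \<delta>2 \<Longrightarrow> H y = Some (G y)"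
    using H unfolding eventually_nhds_metric dist_norm by blast
  define r where "r = \<epsilon> * min \<delta>1 \<delta>2"
  have close: "norm (y - \<mu>) < min \<delta>1 \<delta>2" if "N (y - \<mu>) < r" for y
  proof -
    have "\<epsilon> * norm (y - \<mu>) < \<epsilon> * min \<delta>1 \<delta>2"
      by (rule le_less_trans[OF _ that[unfolded r_def]]) (simp add: N_def)
    then show ?thesis
      using \<open>\<epsilon> > 0\<close> mult_less_cancel_left_pos by blast
  qed
  have contract: "N (G y - \<mu>) \<le> q' * N (y - \<mu>)" if "N (y - \<mu>) < r" for y
  proof -
    define R where "R = G y - G \<mu> - \<phi> (y - \<mu>) *\<^sub>R w"
    have "norm R \<le> e * norm (y - \<mu>)"
      using \<delta>1[of y] close[OF that] by (simp add: R_def)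
    then have "N R \<le> C * (e * norm (y - \<mu>))"
      using \<open>C > 0\<close> \<open>\<epsilon> > 0\<close> by (intro order.trans[OF N_upper] mult_left_mono) auto
    also have "\<dots> \<le> C * (e * (N (y - \<mu>) / \<epsilon>))"
      using N_lower \<open>C > 0\<close> \<open>\<epsilon> > 0\<close> \<open>e > 0\<close> by (intro mult_left_mono) auto
    also have "\<dots> = (1 - q) / 2 * N (y - \<mu>)"
      using \<open>C > 0\<close> \<open>\<epsilon> > 0\<close> by (simp add: e_def)
    finally have "N R \<le> (1 - q) / 2 * N (y - \<mu>)" .
    moreover have "N (G y - \<mu>) \<le> N (\<phi> (y - \<mu>) *\<^sub>R w) + N R"
      using N_add[of "\<phi> (y - \<mu>) *\<^sub>R w" R] by (simp add: R_def G\<mu>)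
    ultimately have "N (G y - \<mu>) \<le> q * N (y - \<mu>) + (1 - q) / 2 * N (y - \<mu>)"
      using N_step[of "y - \<mu>"] by linarith
    also have "\<dots> = q' * N (y - \<mu>)"
      unfolding q'_def by (simp add: algebra_simps add_divide_distrib diff_divide_distrib)
    finally show ?thesis .
  qed
  have N_nonneg: "0 \<le> N z" for z
    using \<open>\<epsilon> > 0\<close> by (simp add: N_def)
  have iter: "N ((G ^^ k) x - \<mu>) \<le> q' ^ k * N (x - \<mu>)" "N ((G ^^ k) x - \<mu>) < r"
    if x: "N (x - \<mu>) < r" for x k
  proof -
    have step: "N ((G ^^ k) x - \<mu>) \<le> q' ^ k * N (x - \<mu>) \<and> N ((G ^^ k) x - \<mu>) < r"
    proof (induction k)
      case (Suc k)
      have "N ((G ^^ Suc k) x - \<mu>) \<le> q' * N ((G ^^ k) x - \<mu>)"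
        unfolding funpow.simps(2) o_apply using Suc by (intro contract) blast
      moreover have "q' * N ((G ^^ k) x - \<mu>) \<le> q' * (q' ^ k * N (x - \<mu>))"
        using Suc q' by (intro mult_left_mono) auto
      moreover have "q' * N ((G ^^ k) x - \<mu>) \<le> 1 * N ((G ^^ k) x - \<mu>)"
        using q' N_nonneg by (intro mult_right_mono) auto
      ultimately show ?case
        using Suc unfolding power_Suc mult.assoc by linarith
    qed (use x in simp)
    show "N ((G ^^ k) x - \<mu>) \<le> q' ^ k * N (x - \<mu>)" "N ((G ^^ k) x - \<mu>) < r"
      using step by auto
  qed
  show ?thesis
    unfolding locally_attracting_def
  proof (intro conjI exI[of _ "{x. N (x - \<mu>) < r}"] ballI fix_pt)
    show "open {x. N (x - \<mu>) < r}"
      unfolding N_def by (intro open_Collect_less continuous_intros continuous_on)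
    show "\<mu> \<in> {x. N (x - \<mu>) < r}"
      using \<open>\<epsilon> > 0\<close> \<open>\<delta>1 > 0\<close> \<open>\<delta>2 > 0\<close> by (simp add: N_def r_def zero)
    fix x assume "x \<in> {x. N (x - \<mu>) < r}"
    then have x: "N (x - \<mu>) < r"
      by simp
    have "(\<lambda>k. q' ^ k * N (x - \<mu>) / \<epsilon>) \<longlonglongrightarrow> 0 * N (x - \<mu>) / \<epsilon>"
      using q' \<open>\<epsilon> > 0\<close> by (intro tendsto_intros LIMSEQ_power_zero) auto
    moreover have "norm ((G ^^ k) x - \<mu>) \<le> q' ^ k * N (x - \<mu>) / \<epsilon>" for k
      using iter(1)[OF x, of k] \<open>\<epsilon> > 0\<close>
      by (intro order.trans[OF N_lower] divide_right_mono) auto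
    ultimately have "(\<lambda>k. (G ^^ k) x - \<mu>) \<longlonglongrightarrow> 0"
      by (intro Lim_null_comparison[of "\<lambda>k. (G ^^ k) x - \<mu>" "\<lambda>k. q' ^ k * N (x - \<mu>) / \<epsilon>"]) auto
    then have "(\<lambda>k. (G ^^ k) x) \<longlonglongrightarrow> \<mu>"
      by (simp add: LIM_zero_iff)
    moreover have "H ((G ^^ k) x) = Some ((G ^^ Suc k) x)" for k
      using \<delta>2 close[OF iter(2)[OF x]] by simp
    ultimately show "\<exists>s. s 0 = x \<and> (\<forall>k. H (s k) = Some (s (Suc k))) \<and> s \<longlonglongrightarrow> \<mu>"
      by (intro exI[of _ "\<lambda>k. (G ^^ k) x"]) auto
  qed
qed

section \<open>The derivative of the iteration map at a zero of the residuals\<close>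

context
  fixes \<iota> :: "'m::finite \<Rightarrow> nat" and i :: nat
  assumes inj: "inj \<iota>" and i: "i \<notin> range \<iota>"
begin

lemma params_nth [simp]:
  "params \<iota> i \<alpha> x (\<iota> a) = fst x $ a" "params \<iota> i \<alpha> x i = snd x"
  using inj i by (auto simp: params_def)

lemma params_upd:
  "(params \<iota> i \<alpha> x)(\<iota> a := t) = params \<iota> i \<alpha> (x + (t - fst x $ a) *\<^sub>R (axis a 1, 0))"
  "(params \<iota> i \<alpha> x)(i := t) = params \<iota> i \<alpha> (x + (t - snd x) *\<^sub>R (0, 1))"
  using inj i by (auto simp: params_def fun_eq_iff axis_def)

text \<open>
  Changing one parameter moves the point along a coordinate line, so the partial derivatives are
  the values of the Frechet derivative at the coordinate vectors.
\<close>

lemma partial_params: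
  assumes G: "((\<lambda>x. G (params \<iota> i \<alpha> x)) has_derivative G') (at x)"
  shows "partial G (\<iota> a) (params \<iota> i \<alpha> x) = G' (axis a 1, 0)"
    and "partial G i (params \<iota> i \<alpha> x) = G' (0, 1)"
proof -
  have line: "deriv (\<lambda>t. G (params \<iota> i \<alpha> (x + (t - s) *\<^sub>R e))) s = G' e" for s e
  proof (rule DERIV_imp_deriv)
    have "((\<lambda>t. x + (t - s) *\<^sub>R e) has_derivative (\<lambda>t. t *\<^sub>R e)) (at s)"
      by (auto intro!: derivative_eq_intros)
    moreover have "((\<lambda>x. G (params \<iota> i \<alpha> x)) has_derivative G') (at (x + (s - s) *\<^sub>R e))"
      using G by simp
    ultimately have "((\<lambda>t. G (params \<iota> i \<alpha> (x + (t - s) *\<^sub>R e))) has_derivative (\<lambda>t. G' (t *\<^sub>R e))) (at s)"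
      by (rule has_derivative_compose)
    moreover have "G' (t *\<^sub>R e) = G' e * t" for t
      using linear_scale[OF has_derivative_linear[OF G], of t e] by simp
    ultimately show "((\<lambda>t. G (params \<iota> i \<alpha> (x + (t - s) *\<^sub>R e))) has_field_derivative G' e) (at s)"
      by (simp add: has_field_derivative_def)
  qed
  show "partial G (\<iota> a) (params \<iota> i \<alpha> x) = G' (axis a 1, 0)"
    "partial G i (params \<iota> i \<alpha> x) = G' (0, 1)"
    by (simp_all only: partial_def params_nth params_upd line)
qed

lemma has_derivative_params:
  assumes G: "((\<lambda>x. G (params \<iota> i \<alpha> x)) has_derivative G') (at x)"
  shows "G' = (\<lambda>z. (\<Sum>a\<in>UNIV. partial G (\<iota> a) (params \<iota> i \<alpha> x) * fst z $ a)
           + partial G i (params \<iota> i \<alpha> x) * snd z)"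
proof
  fix z :: "(real ^ 'm) \<times> real"
  note lin = has_derivative_linear[OF G]
  have "z = (\<Sum>a\<in>UNIV. fst z $ a *\<^sub>R (axis a 1, 0)) + snd z *\<^sub>R (0, 1)"
    using basis_expansion[of "fst z"]
    by (simp add: prod_eq_iff fst_sum snd_sum scalar_mult_eq_scaleR)
  then have "G' z = G' ((\<Sum>a\<in>UNIV. fst z $ a *\<^sub>R (axis a 1, 0)) + snd z *\<^sub>R (0, 1))"
    by simp
  also have "\<dots> = (\<Sum>a\<in>UNIV. partial G (\<iota> a) (params \<iota> i \<alpha> x) * fst z $ a)
           + partial G i (params \<iota> i \<alpha> x) * snd z"
    by (simp only: partial_params[OF G] linear_add[OF lin] linear_sum[OF lin] linear_scale[OF lin])
       (simp add: mult.commute)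
  finally show "G' z = \<dots>" .
qed

text \<open>
  The new value \<open>h\<close> of \<open>\<lambda>\<^sub>i\<close> has derivative \<open>- (r \<bullet> x) / d\<close> in direction \<open>(x, t)\<close>: the
  increment \<open>t\<close> of \<open>\<lambda>\<^sub>i\<close> is cancelled by the term \<open>d t\<close> in the derivative of \<open>F\<^sub>i\<close>. In the final correction
  \<open>A\<^sup>-\<^sup>1\<close> meets the derivative \<open>A g' + h' b\<close> of the residuals along the predicted point, so
  \<open>g'\<close> cancels and only \<open>- h' v\<close> remains, whatever the prediction was.
\<close>

lemma Hmap_derivative:
  fixes F :: "nat \<Rightarrow> (nat \<Rightarrow> real) \<Rightarrow> real" and \<alpha> :: "nat \<Rightarrow> real" and \<mu> :: "(real ^ 'm) \<times> real"
    and D :: "nat \<Rightarrow> (real ^ 'm) \<times> real \<Rightarrow> ((real ^ 'm) \<times> real) \<Rightarrow>\<^sub>L real"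
  defines "l \<equiv> params \<iota> i \<alpha>"
  defines "A \<equiv> Fjac F \<iota> (l \<mu>)" and "b \<equiv> Fcol F \<iota> i (l \<mu>)" and "d \<equiv> partial (F i) i (l \<mu>)"
  defines "v \<equiv> matrix_inv A *v b"
  assumes W: "open W" "\<mu> \<in> W"
    and D: "\<And>j x. j \<in> insert i (range \<iota>) \<Longrightarrow> x \<in> W
        \<Longrightarrow> ((\<lambda>x. F j (l x)) has_derivative blinfun_apply (D j x)) (at x)"
    and D_cont: "\<And>j. j \<in> insert i (range \<iota>) \<Longrightarrow> isCont (D j) \<mu>"
    and zero: "\<And>j. j \<in> insert i (range \<iota>) \<Longrightarrow> F j (l \<mu>) = 0"
    and A: "invertible A" and d: "d \<noteq> 0"
  shows "\<forall>\<^sub>F x in nhds \<mu>. Hmap F \<iota> i \<alpha> x = Some (the (Hmap F \<iota> i \<alpha> x))" (is ?defined)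
    and "((\<lambda>x. the (Hmap F \<iota> i \<alpha> x)) has_derivative
           (\<lambda>z. ((\<Sum>a\<in>UNIV. partial (F i) (\<iota> a) (l \<mu>) * fst z $ a) / d) *\<^sub>R (v, -1))) (at \<mu>)"
      (is ?derivative)
proof -
  define r where "r z = (\<Sum>a\<in>UNIV. partial (F i) (\<iota> a) (l \<mu>) * fst z $ a)"
    for z :: "(real ^ 'm) \<times> real"
  have partial_cont: "isCont (\<lambda>x. partial (F j) k (l x)) \<mu>"
    if j: "j \<in> insert i (range \<iota>)" and k: "k \<in> insert i (range \<iota>)" for j k
  proof -
    \<comment> \<open>On \<open>W\<close> a partial derivative is the evaluation of \<open>D j\<close> at one fixed coordinate vector.\<close>
    have "\<exists>e. \<forall>x\<in>W. partial (F j) k (l x) = D j x e"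
    proof (cases "k = i")
      case True
      then show ?thesis
        using partial_params(2)[OF D[OF j, unfolded l_def]] unfolding l_def by blast
    next
      case False
      with k obtain a where "k = \<iota> a"
        by auto
      then show ?thesis
        using partial_params(1)[OF D[OF j, unfolded l_def]] unfolding l_def by blast
    qed
    then obtain e where e: "\<And>x. x \<in> W \<Longrightarrow> partial (F j) k (l x) = D j x e"
      by blast
    have "isCont (\<lambda>x. D j x e) \<mu>"
      using D_cont[OF j] by (intro continuous_intros)
    moreover have "\<forall>\<^sub>F x in nhds \<mu>. partial (F j) k (l x) = D j x e"
      using eventually_nhds_in_open[OF W] by eventually_elim (rule e)
    ultimately show ?thesis
      by (simp add: isCont_cong)
  qed
  have F_deriv: "((\<lambda>x. F j (l x)) has_derivative
      (\<lambda>z. (\<Sum>a\<in>UNIV. partial (F j) (\<iota> a) (l \<mu>) * fst z $ a) + partial (F j) i (l \<mu>) * snd z)) (at \<mu>)"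
    if j: "j \<in> insert i (range \<iota>)" for j
    using D[OF j W(2)] has_derivative_params[OF D[OF j W(2), unfolded l_def]] by (simp add: l_def)
  have jac_cont: "isCont (\<lambda>x. Fjac F \<iota> (l x)) \<mu>"
    unfolding Fjac_def continuous_at by (intro tendsto_vec_lambda) (auto intro!: partial_cont[unfolded continuous_at])
  have col_cont: "isCont (\<lambda>x. Fcol F \<iota> i (l x)) \<mu>"
    unfolding Fcol_def continuous_at by (intro tendsto_vec_lambda) (auto intro!: partial_cont[unfolded continuous_at])
  have d_cont: "isCont (\<lambda>x. partial (F i) i (l x)) \<mu>"
    by (intro partial_cont) auto
  have Fvec_deriv: "((\<lambda>x. Fvec F \<iota> (l x)) has_derivative (\<lambda>z. A *v fst z + snd z *\<^sub>R b)) (at \<mu>)"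
  proof -
    have "((\<lambda>x. \<chi> a. F (\<iota> a) (l x)) has_derivative
        (\<lambda>z. \<chi> c. (\<Sum>a\<in>UNIV. partial (F (\<iota> c)) (\<iota> a) (l \<mu>) * fst z $ a)
          + partial (F (\<iota> c)) i (l \<mu>) * snd z)) (at \<mu>)"
      by (intro has_derivative_vec_lambda F_deriv) auto
    moreover have "(\<lambda>z. A *v fst z + snd z *\<^sub>R b) =
        (\<lambda>z. \<chi> c. (\<Sum>a\<in>UNIV. partial (F (\<iota> c)) (\<iota> a) (l \<mu>) * fst z $ a)
          + partial (F (\<iota> c)) i (l \<mu>) * snd z)"
      by (simp add: A_def b_def Fjac_def Fcol_def fun_eq_iff vec_eq_iff matrix_vector_mult_def)
    ultimately show ?thesis
      by (simp add: Fvec_def)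
  qed
  define h where "h x = snd x - inverse (partial (F i) i (l x)) * F i (l x)" for x
  define V where "V x = matrix_inv (Fjac F \<iota> (l x)) *v Fcol F \<iota> i (l x)" for x
  define g where "g x = fst x - (h x - snd x) *\<^sub>R V x" for x
  define k where "k x = g x - matrix_inv (Fjac F \<iota> (l (g x, h x))) *v Fvec F \<iota> (l (g x, h x))" for x
  have Hmap_eq: "Hmap F \<iota> i \<alpha> x =
      (if partial (F i) i (l x) \<noteq> 0 \<and> invertible (Fjac F \<iota> (l x)) \<and> invertible (Fjac F \<iota> (l (g x, h x)))
       then Some (k x, h x) else None)" for x
    unfolding Hmap_def Let_def k_def g_def h_def V_def l_def by simp
  have h\<mu>: "h \<mu> = snd \<mu>"
    by (simp add: h_def zero)
  then have g\<mu>: "g \<mu> = fst \<mu>"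
    by (simp add: g_def)
  have h_deriv: "(h has_derivative (\<lambda>z. - (r z / d))) (at \<mu>)"
  proof -
    have "((\<lambda>x. inverse (partial (F i) i (l x))) \<longlongrightarrow> inverse d) (at \<mu>)"
      using d_cont d unfolding continuous_at d_def by (intro tendsto_intros)
    then have "((\<lambda>x. inverse (partial (F i) i (l x)) * F i (l x)) has_derivative
        (\<lambda>z. inverse d * (r z + d * snd z))) (at \<mu>)"
      unfolding r_def d_def
      by (intro bounded_bilinear.has_derivative_prod_zero[OF bounded_bilinear_mult] F_deriv zero) auto
    then have "(h has_derivative (\<lambda>z. snd z - inverse d * (r z + d * snd z))) (at \<mu>)"
      unfolding h_def by (intro derivative_intros)
    moreover have "snd z - inverse d * (r z + d * snd z) = - (r z / d)" for z
      using d by (simp add: field_simps)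
    ultimately show ?thesis
      by simp
  qed
  have g_deriv: "(g has_derivative (\<lambda>z. fst z - (- (r z / d) - snd z) *\<^sub>R v)) (at \<mu>)"
  proof -
    have "(V \<longlongrightarrow> v) (at \<mu>)"
      using jac_cont col_cont A unfolding V_def v_def A_def b_def continuous_at
      by (intro tendsto_matrix_vector_mult tendsto_matrix_inv)
    moreover have "((\<lambda>x. h x - snd x) has_derivative (\<lambda>z. - (r z / d) - snd z)) (at \<mu>)"
      by (intro derivative_intros h_deriv)
    ultimately have "((\<lambda>x. (h x - snd x) *\<^sub>R V x) has_derivative (\<lambda>z. (- (r z / d) - snd z) *\<^sub>R v)) (at \<mu>)"
      by (rule bounded_bilinear.has_derivative_prod_zero[OF bounded_bilinear.flip[OF bounded_bilinear_scaleR]])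
         (simp add: h\<mu>)
    then show ?thesis
      unfolding g_def by (intro derivative_intros)
  qed
  have gh_deriv: "((\<lambda>x. (g x, h x)) has_derivative
      (\<lambda>z. (fst z - (- (r z / d) - snd z) *\<^sub>R v, - (r z / d)))) (at \<mu>)"
    by (intro has_derivative_Pair g_deriv h_deriv)
  have gh_lim: "((\<lambda>x. (g x, h x)) \<longlongrightarrow> \<mu>) (at \<mu>)"
    using has_derivative_continuous[OF gh_deriv] by (simp add: continuous_at g\<mu> h\<mu>)
  have jac'_lim: "((\<lambda>x. Fjac F \<iota> (l (g x, h x))) \<longlongrightarrow> A) (at \<mu>)"
    unfolding A_def using jac_cont gh_lim by (rule isCont_tendsto_compose)
  have Av: "A *v v = b" and invA: "matrix_inv A *v (A *v x) = x" for x
    by (simp_all add: v_def matrix_vector_mul_assoc matrix_inv_mult[OF A])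
  have k_deriv: "(k has_derivative (\<lambda>z. (r z / d) *\<^sub>R v)) (at \<mu>)"
  proof -
    have "((\<lambda>x. Fvec F \<iota> (l (g x, h x))) has_derivative
        (\<lambda>z. A *v (fst z - (- (r z / d) - snd z) *\<^sub>R v) + (- (r z / d)) *\<^sub>R b)) (at \<mu>)"
    proof -
      have "((\<lambda>x. Fvec F \<iota> (l x)) has_derivative (\<lambda>z. A *v fst z + snd z *\<^sub>R b)) (at (g \<mu>, h \<mu>))"
        using Fvec_deriv by (simp add: g\<mu> h\<mu>)
      from has_derivative_compose[OF gh_deriv this] show ?thesis
        by simp
    qed
    moreover have "Fvec F \<iota> (l (g \<mu>, h \<mu>)) = 0"
      by (simp add: g\<mu> h\<mu> Fvec_def zero vec_eq_iff)
    ultimately have "((\<lambda>x. matrix_inv (Fjac F \<iota> (l (g x, h x))) *v Fvec F \<iota> (l (g x, h x))) has_derivative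
        (\<lambda>z. matrix_inv A *v (A *v (fst z - (- (r z / d) - snd z) *\<^sub>R v) + (- (r z / d)) *\<^sub>R b))) (at \<mu>)"
      using tendsto_matrix_inv[OF jac'_lim A]
      by (intro bounded_bilinear.has_derivative_prod_zero[OF bounded_bilinear_matrix_vector_mult])
    from has_derivative_diff[OF g_deriv this]
    have "(k has_derivative (\<lambda>z. fst z - (- (r z / d) - snd z) *\<^sub>R v
        - matrix_inv A *v (A *v (fst z - (- (r z / d) - snd z) *\<^sub>R v) + (- (r z / d)) *\<^sub>R b))) (at \<mu>)"
      by (simp only: k_def[abs_def])
    moreover have "matrix_inv A *v (A *v y + t *\<^sub>R b) = y + t *\<^sub>R v" for y t
      using invA[of "y + t *\<^sub>R v"]
      by (simp add: matrix_vector_right_distrib matrix_vector_mult_scaleR Av)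
    ultimately have "(k has_derivative (\<lambda>z. fst z - (- (r z / d) - snd z) *\<^sub>R v
        - ((fst z - (- (r z / d) - snd z) *\<^sub>R v) + (- (r z / d)) *\<^sub>R v))) (at \<mu>)"
      by (simp only:)
    then show ?thesis
      by simp
  qed
  have "\<forall>\<^sub>F x in at \<mu>. partial (F i) i (l x) \<noteq> 0"
    using d_cont d unfolding continuous_at d_def by (rule tendsto_imp_eventually_ne)
  moreover have "\<forall>\<^sub>F x in at \<mu>. invertible (Fjac F \<iota> (l x))"
    using jac_cont A unfolding continuous_at A_def by (rule eventually_invertible)
  moreover have "\<forall>\<^sub>F x in at \<mu>. invertible (Fjac F \<iota> (l (g x, h x)))"
    using jac'_lim A by (rule eventually_invertible)
  ultimately have ev: "\<forall>\<^sub>F x in at \<mu>. Hmap F \<iota> i \<alpha> x = Some (k x, h x)"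
    by eventually_elim (simp add: Hmap_eq)
  have at\<mu>: "Hmap F \<iota> i \<alpha> \<mu> = Some (k \<mu>, h \<mu>)"
    using A d by (simp add: Hmap_eq g\<mu> h\<mu> A_def d_def)
  have "\<forall>\<^sub>F x in nhds \<mu>. Hmap F \<iota> i \<alpha> x = Some (k x, h x)"
    using ev at\<mu> by (simp add: eventually_nhds_conv_at)
  then show ?defined
    by eventually_elim simp
  have "((\<lambda>x. (k x, h x)) has_derivative (\<lambda>z. ((r z / d) *\<^sub>R v, - (r z / d)))) (at \<mu>)"
    by (intro has_derivative_Pair k_deriv h_deriv)
  moreover have "\<forall>\<^sub>F x in at \<mu>. (k x, h x) = the (Hmap F \<iota> i \<alpha> x)"
    using ev by eventually_elim simp
  ultimately have "((\<lambda>x. the (Hmap F \<iota> i \<alpha> x)) has_derivative (\<lambda>z. ((r z / d) *\<^sub>R v, - (r z / d)))) (at \<mu>)"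
    by (rule has_derivative_transform_eventually) (simp_all add: at\<mu>)
  then show ?derivative
    by (simp add: r_def)
qed

end

lemma derivative_on_interior:
  assumes "twice_differentiable_on G S"
  obtains G' where "\<And>x. x \<in> interior S \<Longrightarrow> (G has_derivative blinfun_apply (G' x)) (at x)"
    and "\<And>x. x \<in> interior S \<Longrightarrow> isCont G' x"
proof -
  obtain G' where G': "\<And>x. x \<in> S \<Longrightarrow> (G has_derivative blinfun_apply (G' x)) (at x within S)"
    and diff: "G' differentiable_on S"
    using assms unfolding twice_differentiable_on_def by blast
  show thesis
  proof (rule that)
    fix x assume x: "x \<in> interior S"
    have "x \<in> S"
      using x interior_subset[of S] by blast
    have at: "at x within S = at x"
      using x by (rule at_within_interior)
    show "(G has_derivative blinfun_apply (G' x)) (at x)"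
      using G'[OF \<open>x \<in> S\<close>] at by simp
    show "isCont G' x"
      using differentiable_imp_continuous_on[OF diff] \<open>x \<in> S\<close> at
      by (auto simp: continuous_on_eq_continuous_within)
  qed
qed

section \<open>The Jacobian of the moment residuals as a Gram matrix\<close>

lemma continuous_on_monomials_upto:
  assumes "m \<in> monomials_upto p"
  shows "continuous_on S m"
  using assms unfolding monomials_upto_def monomial_fun_def by (auto intro!: continuous_intros)

definition exp_density ::
  "nat \<Rightarrow> (nat \<Rightarrow> real ^ 'd \<Rightarrow> real) \<Rightarrow> (nat \<Rightarrow> real) \<Rightarrow> real ^ 'd \<Rightarrow> real" where
  "exp_density n c l x = exp (\<Sum>m=1..n. l m * c m x)"

context
  fixes n :: nat and c :: "nat \<Rightarrow> real ^ 'd \<Rightarrow> real" and f :: "nat \<Rightarrow> real"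
  assumes cont: "\<And>m S. m \<in> {1..n} \<Longrightarrow> continuous_on S (c m)"
begin

text \<open>
  Differentiation under the integral sign: the derivative of the integrand is jointly continuous in
  the parameter and the point of the compact cube.
\<close>

lemma partial_moment_residual:
  assumes j: "j \<in> {1..n}" and k: "k \<in> {1..n}"
  shows "partial (moment_residual n c f j) k l =
    integral cube (\<lambda>x. (c j x - f j) * c k x * exp (\<Sum>m=1..n. l m * c m x))"
proof -
  define E where "E x = (\<Sum>m\<in>{1..n} - {k}. l m * c m x)" for x
  have split: "(\<Sum>m=1..n. (l(k := t)) m * c m x) = t * c k x + E x" for t x
    using k by (simp add: E_def sum.remove[of _ k])
  have cont_snd: "continuous_on S (\<lambda>z. c m (snd z))"
    if "m \<in> {1..n}" for m and S :: "(real \<times> (real ^ 'd)) set"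
    by (rule continuous_on_compose2[OF cont[OF that, of UNIV]]) (auto intro: continuous_intros)
  have "((\<lambda>t. integral cube (\<lambda>x. (c j x - f j) * exp (t * c k x + E x))) has_field_derivative
      integral cube (\<lambda>x. (c j x - f j) * c k x * exp (l k * c k x + E x))) (at (l k))"
    unfolding cube_def
  proof (rule leibniz_rule_field_derivative[where U = UNIV, unfolded])
    show "((\<lambda>t. (c j x - f j) * exp (t * c k x + E x)) has_field_derivative
        (c j x - f j) * c k x * exp (t * c k x + E x)) (at t)" for t x
      by (auto intro!: derivative_eq_intros)
    show "(\<lambda>x. (c j x - f j) * exp (t * c k x + E x)) integrable_on cbox (\<chi> k. - 1) (\<chi> k. 1)" for t
      unfolding E_def using j k by (intro integrable_continuous continuous_intros cont) auto
    show "continuous_on (UNIV \<times> cbox (\<chi> k. - 1) (\<chi> k. 1))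
        (\<lambda>(t, x). (c j x - f j) * c k x * exp (t * c k x + E x))"
      unfolding E_def case_prod_beta using j k by (intro continuous_intros cont_snd) auto
  qed auto
  then have "deriv (\<lambda>t. integral cube (\<lambda>x. (c j x - f j) * exp (t * c k x + E x))) (l k) =
      integral cube (\<lambda>x. (c j x - f j) * c k x * exp (l k * c k x + E x))"
    by (rule DERIV_imp_deriv)
  then show ?thesis
    unfolding partial_def moment_residual_def split split[of "l k", unfolded fun_upd_triv] .
qed

context
  fixes \<kappa> :: "'k::finite \<Rightarrow> nat" and l :: "nat \<Rightarrow> real"
  assumes \<kappa>: "\<And>a. \<kappa> a \<in> {1..n}" and zero: "\<And>a. moment_residual n c f (\<kappa> a) l = 0"
begin

lemma integrable_exp_density:
  assumes "continuous_on cube h"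
  shows "(\<lambda>x. h x * exp_density n c l x) integrable_on cube"
  using assms unfolding exp_density_def cube_def
  by (intro integrable_continuous continuous_intros cont) auto

text \<open>
  At a zero of the residuals \<open>c\<^sub>k\<close> can be replaced by \<open>c\<^sub>k - f\<^sub>k\<close> under the integral, because
  the difference is the multiple \<open>f\<^sub>k\<close> of a vanishing integral. This is what makes the Jacobian
  symmetric.
\<close>

lemma Fjac_gram:
  "Fjac (moment_residual n c f) \<kappa> l $ a $ b =
     integral cube (\<lambda>x. (c (\<kappa> a) x - f (\<kappa> a)) * (c (\<kappa> b) x - f (\<kappa> b)) * exp_density n c l x)"
proof -
  have "integral cube (\<lambda>x. (c (\<kappa> a) x - f (\<kappa> a)) * c (\<kappa> b) x * exp_density n c l x)
      = integral cube (\<lambda>x. (c (\<kappa> a) x - f (\<kappa> a)) * c (\<kappa> b) x * exp_density n c l x)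
        - f (\<kappa> b) * integral cube (\<lambda>x. (c (\<kappa> a) x - f (\<kappa> a)) * exp_density n c l x)"
    using zero[of a] by (simp add: moment_residual_def exp_density_def)
  also have "\<dots> = integral cube (\<lambda>x. (c (\<kappa> a) x - f (\<kappa> a)) * c (\<kappa> b) x * exp_density n c l x
        - f (\<kappa> b) * ((c (\<kappa> a) x - f (\<kappa> a)) * exp_density n c l x))"
    by (subst integral_diff)
       (auto intro!: integrable_exp_density integrable_on_mult_right continuous_intros cont \<kappa>)
  finally show ?thesis
    using \<kappa> by (simp add: Fjac_def partial_moment_residual exp_density_def algebra_simps)
qed

lemma Fjac_symmetric:
  "transpose (Fjac (moment_residual n c f) \<kappa> l) = Fjac (moment_residual n c f) \<kappa> l"
proof -
  have "Fjac (moment_residual n c f) \<kappa> l $ a $ b = Fjac (moment_residual n c f) \<kappa> l $ b $ a" for a b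
    unfolding Fjac_gram by (simp add: mult_ac)
  then show ?thesis
    by (simp add: transpose_def vec_eq_iff)
qed

text \<open>
  The quadratic form of a Gram matrix is the integral of the squared linear combination.
\<close>

lemma Fjac_psd:
  "0 \<le> u \<bullet> (Fjac (moment_residual n c f) \<kappa> l *v u)"
proof -
  have "u \<bullet> (Fjac (moment_residual n c f) \<kappa> l *v u) = (\<Sum>a\<in>UNIV. \<Sum>b\<in>UNIV.
      integral cube (\<lambda>x. u $ a * u $ b * ((c (\<kappa> a) x - f (\<kappa> a)) * (c (\<kappa> b) x - f (\<kappa> b)) * exp_density n c l x)))"
    by (simp add: inner_vec_def matrix_vector_mult_def Fjac_gram sum_distrib_left mult_ac)
  also have "\<dots> = integral cube (\<lambda>x. \<Sum>a\<in>UNIV. \<Sum>b\<in>UNIV.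
      u $ a * u $ b * ((c (\<kappa> a) x - f (\<kappa> a)) * (c (\<kappa> b) x - f (\<kappa> b)) * exp_density n c l x))"
    by (rule integral_unique[symmetric], intro has_integral_sum integrable_integral
          integrable_on_mult_right integrable_exp_density continuous_intros cont \<kappa>) auto
  also have "\<dots> = integral cube (\<lambda>x. (\<Sum>a\<in>UNIV. u $ a * (c (\<kappa> a) x - f (\<kappa> a)))\<^sup>2 * exp_density n c l x)"
    by (intro arg_cong[where f = "integral cube"]) (simp add: fun_eq_iff power2_eq_square sum_product sum_distrib_left sum_distrib_right mult_ac)
  also have "\<dots> \<ge> 0"
    by (intro integral_nonneg integrable_exp_density continuous_intros cont \<kappa>) (simp add: exp_density_def)
  finally show ?thesis .
qed

end

end

section \<open>Local convergence\<close>

theorem theorem4p2: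
  fixes p n i :: nat
    and c :: "nat \<Rightarrow> real ^ 'd \<Rightarrow> real"
    and f \<alpha> :: "nat \<Rightarrow> real"
    and F :: "nat \<Rightarrow> (nat \<Rightarrow> real) \<Rightarrow> real"
    and \<iota> :: "'m::finite \<Rightarrow> nat"
    and \<mu> :: "(real ^ 'm) \<times> real"
    and \<sigma> :: "nat \<Rightarrow> complex"
  assumes enum: "bij_betw c {1..n} (monomials_upto p)"
    and F: "F = moment_residual n c f"
    and i: "2 \<le> i" "i \<le> n"
    and index: "bij_betw \<iota> UNIV {1..<i}"
    and fixed_point: "Hmap F \<iota> i \<alpha> \<mu> = Some \<mu>"
    and zero: "Fvec F (case_option i \<iota>) (params \<iota> i \<alpha> \<mu>) = 0"
    and partial_nonzero: "partial (F i) i (params \<iota> i \<alpha> \<mu>) \<noteq> 0"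
    and nonsingular: "invertible (Fjac F (case_option i \<iota>) (params \<iota> i \<alpha> \<mu>))"
    and smooth: "\<exists>S. closed S \<and> connected S \<and> \<mu> \<in> interior S \<and>
           (\<forall>j\<in>{1..i}. twice_differentiable_on (\<lambda>x. F j (params \<iota> i \<alpha> x)) S)"
    and eigenvalues: "eigenvalues_by_modulus (Fjac F \<iota> (params \<iota> i \<alpha> \<mu>)) \<sigma>"
    and bound: "\<bar>inverse (partial (F i) i (params \<iota> i \<alpha> \<mu>)) *
           (\<Sum>j=1..i-1. partial (F j) i (params \<iota> i \<alpha> \<mu>) * partial (F i) j (params \<iota> i \<alpha> \<mu>))\<bar>
         < cmod (\<sigma> (i - 1))"
  shows "locally_attracting (Hmap F \<iota> i \<alpha>) \<mu>"
proof -
  define l where "l = params \<iota> i \<alpha> \<mu>"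
  define M where "M = Fjac F (case_option i \<iota>) l"
  define A where "A = Fjac F \<iota> l"
  define b where "b = Fcol F \<iota> i l"
  define v where "v = matrix_inv A *v b"
  define d where "d = partial (F i) i l"
  define r where "r z = (\<Sum>a\<in>UNIV. partial (F i) (\<iota> a) l * fst z $ a)" for z :: "(real ^ 'm) \<times> real"
  have inj: "inj \<iota>" and range: "range \<iota> = {1..<i}"
    using index by (auto simp: bij_betw_def)
  have i_notin: "i \<notin> range \<iota>" and indices: "insert i (range \<iota>) = {1..i}"
    using i by (auto simp: range)
  have \<kappa>: "case_option i \<iota> a \<in> {1..n}" for a
  proof (cases a)
    case (Some a')
    then show ?thesis
      using rangeI[of \<iota> a'] i unfolding range by simp
  qed (use i in simp)
  have zero_F: "F j l = 0" if "j \<in> insert i (range \<iota>)" for j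
  proof -
    have "F (case_option i \<iota> a) l = 0" for a
      using zero by (simp add: Fvec_def vec_eq_iff l_def)
    from this[of None] this[of "Some _"] show ?thesis
      using that by auto
  qed
  have cont: "continuous_on S (c m)" if "m \<in> {1..n}" for m S
    using enum that by (intro continuous_on_monomials_upto[of _ p]) (auto simp: bij_betw_def)
  have zero_\<kappa>: "moment_residual n c f (case_option i \<iota> a) l = 0" for a
    using zero_F[of "case_option i \<iota> a"] by (cases a) (auto simp: F)
  have A: "invertible A"
    using fixed_point by (auto simp: Hmap_def Let_def A_def l_def split: if_splits)
  have d: "d \<noteq> 0"
    using partial_nonzero by (simp add: d_def l_def)
  have "A *v v = b"
    by (simp add: v_def matrix_vector_mul_assoc matrix_inv_mult[OF A])
  then have "(A *v v) $ a = b $ a" for a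
    by simp
  then have v: "(\<Sum>b\<in>UNIV. M $ Some a $ Some b * v $ b) = M $ Some a $ None" for a
    by (simp add: M_def A_def b_def Fjac_def Fcol_def matrix_vector_mult_def)
  have inv: "invertible M"
    using nonsingular by (simp add: M_def l_def)
  have "0 \<le> u \<bullet> (M *v u)" "transpose M = M" for u
    unfolding M_def F
    using Fjac_psd[OF cont \<kappa> zero_\<kappa>] Fjac_symmetric[OF cont \<kappa> zero_\<kappa>] by auto
  \<comment> \<open>By symmetry the last row of \<open>M\<close> is the last column, so \<open>r \<bullet> v\<close> is \<open>b \<bullet> A\<^sup>-\<^sup>1 b\<close>.\<close>
  note schur = schur_complement_pos[OF this inv v]
  have "r (v, -1) = (\<Sum>a\<in>UNIV. M $ None $ Some a * v $ a)" "d = M $ None $ None"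
    by (simp_all add: r_def d_def M_def Fjac_def)
  with schur have small: "\<bar>r (v, -1) / d\<bar> < 1"
    by simp

  obtain S where "\<mu> \<in> interior S"
    and S: "\<And>j. j \<in> {1..i} \<Longrightarrow> twice_differentiable_on (\<lambda>x. F j (params \<iota> i \<alpha> x)) S"
    using smooth by blast
  have "\<exists>G'. (\<forall>x\<in>interior S. ((\<lambda>x. F j (params \<iota> i \<alpha> x)) has_derivative blinfun_apply (G' x)) (at x))
      \<and> isCont G' \<mu>" if "j \<in> insert i (range \<iota>)" for j
    using derivative_on_interior[OF S] that \<open>\<mu> \<in> interior S\<close> unfolding indices by metis
  then obtain D where D: "\<And>j x. j \<in> insert i (range \<iota>) \<Longrightarrow> x \<in> interior S \<Longrightarrow>
      ((\<lambda>x. F j (params \<iota> i \<alpha> x)) has_derivative blinfun_apply (D j x)) (at x)"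
    and D_cont: "\<And>j. j \<in> insert i (range \<iota>) \<Longrightarrow> isCont (D j) \<mu>"
    by metis
  note H = Hmap_derivative[OF inj i_notin open_interior \<open>\<mu> \<in> interior S\<close> D D_cont
      zero_F[unfolded l_def] A[unfolded A_def l_def] d[unfolded d_def l_def]]
  show ?thesis
  proof (rule locally_attracting_rank_one[OF fixed_point H(1)])
    show "((\<lambda>x. the (Hmap F \<iota> i \<alpha> x)) has_derivative (\<lambda>z. (r z / d) *\<^sub>R (v, -1))) (at \<mu>)"
      using H(2) by (simp only: r_def d_def v_def A_def b_def l_def)
    show "bounded_linear (\<lambda>z. r z / d)"
      unfolding linear_conv_bounded_linear[symmetric]
      by (auto intro!: linearI
          simp: r_def algebra_simps sum.distrib add_divide_distrib sum_distrib_left)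
    show "\<bar>r (v, -1) / d\<bar> < 1"
      by (rule small)
  qed
qed

end
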